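(* There exist a circuit $c$ and an initial state $st_0$ such that the desynchronization marked graph $DS_c$ does not ensure flow equivalence of $c$ with initial state $st_0$; that is, there exist a latch $l$, a trace $t$ with $DS_c\vdash t\Downarrow m$ for some marking $m$, and a value $v$ such that $\mathrm{transp}(t,l)=\mathrm{Opaque}$, $\langle c,st_0\rangle\vdash t\downarrow l\mapsto v$, and $v\neq \mathrm{sync}(c,st_0,\mathrm{num}(l-,t))(l)$.
   Context: A value is either $\mathrm{Num}(n)$ with $n\in\mathbb N$ or the undefined value $X$. A circuit $c$ consists of: a set of even latches and a set of odd latches (the latches of $c$ are their disjoint union); a finite list of pairs $(E,O)$ with $E$ even, $O$ odd, and a finite list of pairs $(O,E)$ with $O$ odd, $E$ even, where a pair $(l,l')$ in either list means $l$ is a left neighbor of $l'$ (and $l'$ a right neighbor of $l$); and for each latch $l$ a next-state function mapping an assignment of values to the left neighbors of $l$ to a value. A state is a function from latches to values; $\mathrm{next}_c(st,l)$ denotes the next-state function of $l$ applied to the restriction of $st$ to the left neighbors of $l$. Synchronous execution: $\mathrm{sync}(c,st_0,n)(l)$ equals $st_0(l)$ if $n=0$ and $l$ even; $X$ if $n=0$ and $l$ odd; $\mathrm{next}_c(\mathrm{sync}(c,st_0,n),l)$ if $n>0$ and $l$ even; $\mathrm{next}_c(\mathrm{sync}(c,st_0,n-1),l)$ if $n>0$ and $l$ odd. Events are $l+$ (rise of the clock of latch $l$) and $l-$ (fall). A trace is a finite sequence of events; $\varepsilon$ is the empty trace and $t\triangleright e$ is $t$ extended by event $e$ as its most recent event.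 $\mathrm{num}(e,t)$ is the number of occurrences of $e$ in $t$. Transparency: $\mathrm{transp}(\varepsilon,l)=\mathrm{Transparent}$ if $l$ odd, $\mathrm{Opaque}$ if $l$ even; $\mathrm{transp}(t\triangleright l+,l)=\mathrm{Transparent}$; $\mathrm{transp}(t\triangleright l-,l)=\mathrm{Opaque}$; $\mathrm{transp}(t\triangleright e,l)=\mathrm{transp}(t,l)$ for other events $e$. Asynchronous execution: $\langle c,st_0\rangle\vdash t\downarrow l\mapsto v$ is the smallest relation on (trace, latch, value) closed under: (1) if $\mathrm{transp}(t,l)=\mathrm{Transparent}$ and $st$ is a state such that $\langle c,st_0\rangle\vdash t\downarrow l'\mapsto st(l')$ for every left neighbor $l'$ of $l$, then $\langle c,st_0\rangle\vdash t\downarrow l\mapsto \mathrm{next}_c(st,l)$; (2) for every even $l$, $\langle c,st_0\rangle\vdash \varepsilon\downarrow l\mapsto st_0(l)$; (3) if $\mathrm{transp}(t'\triangleright e,l)=\mathrm{Opaque}$, $e\neq l-$, and $\langle c,st_0\rangle\vdash t'\downarrow l\mapsto v$ with $\mathrm{transp}(t',l)=\mathrm{Opaque}$, then $\langle c,st_0\rangle\vdash t'\triangleright e\downarrow l\mapsto v$; (4) if $st$ is a state with $\langle c,st_0\rangle\vdash t'\downarrow l'\mapsto st(l')$ for every left neighbor $l'$ of $l$, then $\langle c,st_0\rangle\vdash t'\triangleright l-\downarrow l\mapsto \mathrm{next}_c(st,l)$. A marked graph over the set of events consists of a set of places, each with a unique input event and a unique output event, and an initial marking $m_0$ (places $\to\mathbb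 N$). An event $e$ is enabled in a marking $m$ if $m(p)>0$ for every place $p$ with output event $e$; firing $e$ yields $m'$ with $m'(p)=m(p)-1$ if $p$'s output event is $e$, $m(p)+1$ if $p$'s input event is $e$, $m(p)$ otherwise. $M\vdash t\Downarrow m$ is defined inductively: $M\vdash\varepsilon\Downarrow m_0$; if $M\vdash t'\Downarrow m'$ and $e$ is enabled in $m'$, then $M\vdash t'\triangleright e\Downarrow m$ with $m$ the result of firing $e$ in $m'$. A marked graph $M$ ensures flow equivalence of $c$ with initial state $st_0$ if for all latches $l$, traces $t$ and values $v$: if $M\vdash t\Downarrow m$ for some $m$, $\mathrm{transp}(t,l)=\mathrm{Opaque}$ and $\langle c,st_0\rangle\vdash t\downarrow l\mapsto v$, then $v=\mathrm{sync}(c,st_0,\mathrm{num}(l-,t))(l)$. The desynchronization marked graph $DS_c$ has places (input $\to$ output) with initial markings: for each latch $l$, a place $l+\to l-$ with initial marking $1$ if $l$ odd, $0$ if $l$ even, and a place $l-\to l+$ with initial marking $1$ if $l$ even, $0$ if $l$ odd; for each neighbor pair $(l,l')$ ($l$ a left neighbor of $l'$), a place $l+\to l'-$ with initial marking $1$, and a place $l'-\to l+$ with initial marking $0$. *)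

theory Defs
  imports Main "HOL-Library.FuncSet"
begin

section \<open>Circuits\<close>

datatype "value" = Num nat | X

text \<open>The latches are tagged with their parity, so that even and odd latches are disjoint by
  construction.\<close>

datatype ('e, 'o) latch = Even 'e | Odd 'o

type_synonym ('e, 'o) state = "('e, 'o) latch \<Rightarrow> value"

text \<open>The field \<open>next_fun\<close> is only ever applied to assignments that are \<^term>\<open>undefined\<close> outside the
  left neighbors of the latch (see \<open>next_state\<close> below).\<close>

record ('e, 'o) circuit =
  evens :: "'e set"
  odds :: "'o set"
  even_odd :: "('e \<times> 'o) list"
  odd_even :: "('o \<times> 'e) list"
  next_fun :: "('e, 'o) latch \<Rightarrow> ('e, 'o) state \<Rightarrow> value"

definition wf_circuit :: "('e, 'o) circuit \<Rightarrow> bool" where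
  "wf_circuit c \<longleftrightarrow>
     set (even_odd c) \<subseteq> evens c \<times> odds c \<and> set (odd_even c) \<subseteq> odds c \<times> evens c"

definition latches :: "('e, 'o) circuit \<Rightarrow> ('e, 'o) latch set" where
  "latches c = Even ` evens c \<union> Odd ` odds c"

fun left_neighbors :: "('e, 'o) circuit \<Rightarrow> ('e, 'o) latch \<Rightarrow> ('e, 'o) latch set" where
  "left_neighbors c (Even e) = {Odd d | d. (d, e) \<in> set (odd_even c)}"
| "left_neighbors c (Odd d) = {Even e | e. (e, d) \<in> set (even_odd c)}"

definition next_state :: "('e, 'o) circuit \<Rightarrow> ('e, 'o) state \<Rightarrow> ('e, 'o) latch \<Rightarrow> value" where
  "next_state c st l = next_fun c l (restrict st (left_neighbors c l))"

lemma next_state_cong [fundef_cong]: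
  assumes "c = c'" and "l = l'" and "\<And>k. k \<in> left_neighbors c' l' \<Longrightarrow> st k = st' k"
  shows "next_state c st l = next_state c' st' l'"
proof -
  have "restrict st (left_neighbors c' l') = restrict st' (left_neighbors c' l')"
    using assms(3) by (rule restrict_ext)
  then show ?thesis
    using assms(1,2) by (simp add: next_state_def)
qed


section \<open>Synchronous execution\<close>

function sync :: "('e, 'o) circuit \<Rightarrow> ('e, 'o) state \<Rightarrow> nat \<Rightarrow> ('e, 'o) state" where
  "sync c st0 0 (Even e) = st0 (Even e)"
| "sync c st0 0 (Odd d) = X"
| "sync c st0 (Suc n) (Even e) = next_state c (\<lambda>l. sync c st0 (Suc n) l) (Even e)"
| "sync c st0 (Suc n) (Odd d) = next_state c (\<lambda>l. sync c st0 n l) (Odd d)"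
  by pat_completeness auto
termination
  by (relation "measures [\<lambda>(c, st0, n, l). n, \<lambda>(c, st0, n, l). case l of Even _ \<Rightarrow> 1 | Odd _ \<Rightarrow> 0]")
    auto


section \<open>Asynchronous execution\<close>

datatype 'l event = Rise 'l | Fall 'l

text \<open>Traces are lists with the most recent event at the head: \<open>e # t\<close> is \<open>t\<close> extended by \<open>e\<close>, and
  the number of occurrences of \<open>e\<close> in \<open>t\<close> is \<open>count_list t e\<close>.\<close>

type_synonym 'l trace = "'l event list"

datatype transparency = Transparent | Opaque

fun transparency_of :: "('e, 'o) latch trace \<Rightarrow> ('e, 'o) latch \<Rightarrow> transparency" where
  "transparency_of [] (Even e) = Opaque"
| "transparency_of [] (Odd d) = Transparent"
| "transparency_of (e # t) l =
     (if e = Rise l then Transparent else if e = Fall l then Opaque else transparency_of t l)"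

inductive async ::
  "('e, 'o) circuit \<Rightarrow> ('e, 'o) state \<Rightarrow> ('e, 'o) latch trace \<Rightarrow> ('e, 'o) latch \<Rightarrow> value \<Rightarrow> bool"
  for c :: "('e, 'o) circuit" and st0 :: "('e, 'o) state" where
  transparent: "async c st0 t l (next_state c st l)"
    if "l \<in> latches c" and "transparency_of t l = Transparent"
      and "\<forall>l' \<in> left_neighbors c l. async c st0 t l' (st l')"
| initial: "async c st0 [] (Even e) (st0 (Even e))"
    if "e \<in> evens c"
| opaque: "async c st0 (e # t) l v"
    if "transparency_of (e # t) l = Opaque" and "e \<noteq> Fall l"
      and "async c st0 t l v" and "transparency_of t l = Opaque"
| fall: "async c st0 (Fall l # t) l (next_state c st l)"
    if "l \<in> latches c" and "\<forall>l' \<in> left_neighbors c l. async c st0 t l' (st l')"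


section \<open>Marked graphs\<close>

record ('p, 'a) marked_graph =
  events :: "'a set"
  places :: "'p set"
  input_event :: "'p \<Rightarrow> 'a"
  output_event :: "'p \<Rightarrow> 'a"
  initial_marking :: "'p \<Rightarrow> nat"

definition wf_marked_graph :: "('p, 'a) marked_graph \<Rightarrow> bool" where
  "wf_marked_graph M \<longleftrightarrow> (\<forall>p \<in> places M. input_event M p \<in> events M \<and> output_event M p \<in> events M)"

definition enabled :: "('p, 'a) marked_graph \<Rightarrow> ('p \<Rightarrow> nat) \<Rightarrow> 'a \<Rightarrow> bool" where
  "enabled M m e \<longleftrightarrow> e \<in> events M \<and> (\<forall>p \<in> places M. output_event M p = e \<longrightarrow> m p > 0)"

definition fire :: "('p, 'a) marked_graph \<Rightarrow> 'a \<Rightarrow> ('p \<Rightarrow> nat) \<Rightarrow> ('p \<Rightarrow> nat)" where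
  "fire M e m = (\<lambda>p. if output_event M p = e then m p - 1
                     else if input_event M p = e then m p + 1
                     else m p)"

inductive reaches :: "('p, 'a) marked_graph \<Rightarrow> 'a list \<Rightarrow> ('p \<Rightarrow> nat) \<Rightarrow> bool"
  for M :: "('p, 'a) marked_graph" where
  "reaches M [] (initial_marking M)"
| "reaches M (e # t) (fire M e m)" if "reaches M t m" and "enabled M m e"


section \<open>Flow equivalence and the desynchronization marked graph\<close>

definition ensures_flow_equivalence ::
  "('p, ('e, 'o) latch event) marked_graph \<Rightarrow> ('e, 'o) circuit \<Rightarrow> ('e, 'o) state \<Rightarrow> bool" where
  "ensures_flow_equivalence M c st0 \<longleftrightarrow>
     (\<forall>l \<in> latches c. \<forall>t v.
        (\<exists>m. reaches M t m) \<and> transparency_of t l = Opaque \<and> async c st0 t l v \<longrightarrow>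
        v = sync c st0 (count_list t (Fall l)) l)"

text \<open>\<open>Rise_Fall l\<close> is the place from the rise to the fall of \<open>l\<close>, and \<open>Fall_Rise l\<close> the one back.
  For a left neighbor \<open>l\<close> of \<open>l'\<close>, \<open>Left_Rise l l'\<close> is the place from the rise of \<open>l\<close> to the fall of
  \<open>l'\<close>, and \<open>Right_Fall l l'\<close> the one from the fall of \<open>l'\<close> to the rise of \<open>l\<close>.\<close>

datatype 'l ds_place = Rise_Fall 'l | Fall_Rise 'l | Left_Rise 'l 'l | Right_Fall 'l 'l

fun ds_input :: "'l ds_place \<Rightarrow> 'l event" where
  "ds_input (Rise_Fall l) = Rise l"
| "ds_input (Fall_Rise l) = Fall l"
| "ds_input (Left_Rise l l') = Rise l"
| "ds_input (Right_Fall l l') = Fall l'"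

fun ds_output :: "'l ds_place \<Rightarrow> 'l event" where
  "ds_output (Rise_Fall l) = Fall l"
| "ds_output (Fall_Rise l) = Rise l"
| "ds_output (Left_Rise l l') = Fall l'"
| "ds_output (Right_Fall l l') = Rise l"

fun ds_marking :: "('e, 'o) latch ds_place \<Rightarrow> nat" where
  "ds_marking (Rise_Fall (Even e)) = 0"
| "ds_marking (Rise_Fall (Odd d)) = 1"
| "ds_marking (Fall_Rise (Even e)) = 1"
| "ds_marking (Fall_Rise (Odd d)) = 0"
| "ds_marking (Left_Rise l l') = 1"
| "ds_marking (Right_Fall l l') = 0"

definition desync_graph ::
  "('e, 'o) circuit \<Rightarrow> (('e, 'o) latch ds_place, ('e, 'o) latch event) marked_graph" where
  "desync_graph c =
     \<lparr>events = Rise ` latches c \<union> Fall ` latches c,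
      places = Rise_Fall ` latches c \<union> Fall_Rise ` latches c
        \<union> {Left_Rise l l' | l l'. l' \<in> latches c \<and> l \<in> left_neighbors c l'}
        \<union> {Right_Fall l l' | l l'. l' \<in> latches c \<and> l \<in> left_neighbors c l'},
      input_event = ds_input,
      output_event = ds_output,
      initial_marking = ds_marking\<rparr>"

lemma wf_desync_graph:
  assumes "wf_circuit c"
  shows "wf_marked_graph (desync_graph c)"
proof -
  have "l \<in> latches c" if "l \<in> left_neighbors c l'" for l l'
    using assms that by (cases l') (auto simp: wf_circuit_def latches_def)
  then show ?thesis
    by (auto simp: wf_marked_graph_def desync_graph_def)
qed

end

theory Submission imports Defs begin

text \<open>In the pipeline \<open>Even 0 \<rightarrow> Odd 0 \<rightarrow> Even 1\<close>, no place of the desynchronization graph makes the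
  second rise of \<open>Odd 0\<close> wait for the first rise of its left neighbor \<open>Even 0\<close>. Hence \<open>Odd 0\<close> and
  \<open>Even 1\<close> can go through a second round while \<open>Even 0\<close> still holds its initial value, and
  \<open>Even 1\<close> latches that value twice.\<close>

definition pipeline :: "(nat, nat) circuit" where
  "pipeline = \<lparr>evens = {0, 1}, odds = {0}, even_odd = [(0, 0)], odd_even = [(0, 1)],
     next_fun = (\<lambda>l s. case l of Even e \<Rightarrow> if e = 0 then Num 1 else s (Odd 0)
                              | Odd d \<Rightarrow> s (Even 0))\<rparr>"

text \<open>Chronologically from right to left. \<open>Odd 0\<close> starts transparent, so it falls
  before it rises; \<open>Even 0\<close> never moves.\<close>

definition stale_trace :: "(nat, nat) latch trace" where
  "stale_trace = [Fall (Even 1), Rise (Even 1), Rise (Odd 0),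
     Fall (Even 1), Rise (Even 1), Fall (Odd 0)]"

lemma wf_pipeline: "wf_circuit pipeline"
  by (simp add: wf_circuit_def pipeline_def)

lemma latches_pipeline: "latches pipeline = {Even 0, Even 1, Odd 0}"
  by (auto simp: latches_def pipeline_def)

lemma left_neighbors_pipeline:
  "left_neighbors pipeline (Even e) = (if e = 1 then {Odd 0} else {})"
  "left_neighbors pipeline (Odd d) = (if d = 0 then {Even 0} else {})"
  by (auto simp: pipeline_def)

text \<open>Each next-state function reads at most its left neighbor, so \<open>restrict\<close>
  loses nothing. \<open>Suc 0\<close> is the form simp gives to \<open>1\<close>.\<close>

lemma next_state_pipeline:
  "next_state pipeline s (Even 0) = Num 1"
  "next_state pipeline s (Even (Suc 0)) = s (Odd 0)"
  "next_state pipeline s (Odd 0) = s (Even 0)"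
  by (simp_all add: next_state_def left_neighbors_pipeline del: left_neighbors.simps)
    (simp_all add: pipeline_def)

lemma places_pipeline:
  "places (desync_graph pipeline) =
     {Rise_Fall (Even 0), Rise_Fall (Even 1), Rise_Fall (Odd 0),
      Fall_Rise (Even 0), Fall_Rise (Even 1), Fall_Rise (Odd 0),
      Left_Rise (Even 0) (Odd 0), Left_Rise (Odd 0) (Even 1),
      Right_Fall (Even 0) (Odd 0), Right_Fall (Odd 0) (Even 1)}"
  by (auto simp: desync_graph_def latches_pipeline left_neighbors_pipeline
      simp del: left_neighbors.simps)

lemma events_pipeline:
  "events (desync_graph pipeline) = Rise ` {Even 0, Even 1, Odd 0} \<union> Fall ` {Even 0, Even 1, Odd 0}"
  by (simp add: desync_graph_def latches_pipeline)

lemma desync_graph_sel: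
  "input_event (desync_graph c) = ds_input"
  "output_event (desync_graph c) = ds_output"
  "initial_marking (desync_graph c) = ds_marking"
  by (simp_all add: desync_graph_def)

text \<open>The single initial token on \<open>Left_Rise (Even 0) (Odd 0)\<close> suffices, since
  \<open>Odd 0\<close> falls only once.\<close>

lemma reaches_stale_trace: "\<exists>m. reaches (desync_graph pipeline) stale_trace m"
  unfolding stale_trace_def
  by (rule exI, (rule reaches.intros)+)
    (simp_all add: enabled_def fire_def places_pipeline events_pipeline desync_graph_sel)

lemma async_stale_trace: "async pipeline (\<lambda>_. Num 0) stale_trace (Even 1) (Num 0)"
proof -
  let ?c = pipeline and ?s = "(\<lambda>_. Num 0) :: (nat, nat) state" and ?t = "tl stale_trace"
  have "async ?c ?s [] (Even 0) (?s (Even 0))"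
    by (rule async.initial) (simp add: pipeline_def)
  \<comment> \<open>Without events of \<open>Even 0\<close>, rule \<open>opaque\<close> carries its
    initial value along the whole trace.\<close>
  then have "async ?c ?s ?t (Even 0) (Num 0)"
    by (simp add: stale_trace_def async.opaque)
  \<comment> \<open>After its rise \<open>Odd 0\<close> is transparent; the constant state
    \<open>?s\<close> fits because \<open>Even 0\<close> still holds \<open>Num 0\<close>.\<close>
  then have "async ?c ?s ?t (Odd 0) (next_state ?c ?s (Odd 0))"
    by (intro async.transparent)
      (simp_all add: latches_pipeline left_neighbors_pipeline stale_trace_def
        del: left_neighbors.simps)
  then have "async ?c ?s (Fall (Even 1) # ?t) (Even 1) (next_state ?c ?s (Even 1))"
    by (intro async.fall)
      (simp_all add: latches_pipeline left_neighbors_pipeline next_state_pipeline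
        del: left_neighbors.simps)
  then show ?thesis
    by (simp add: next_state_pipeline stale_trace_def)
qed

text \<open>Odd latches read the previous round, so the \<open>Num 1\<close> of
  \<open>Even 0\<close> from round 1 reaches \<open>Odd 0\<close>, and with it
  \<open>Even 1\<close>, in round 2.\<close>

lemma sync_pipeline: "sync pipeline st0 2 (Even 1) = Num 1"
  by (simp add: numeral_2_eq_2 next_state_pipeline)

theorem theorem3:
  "\<exists>(c :: (nat, nat) circuit) (st0 :: (nat, nat) state).
     wf_circuit c \<and> \<not> ensures_flow_equivalence (desync_graph c) c st0"
proof (intro exI conjI notI)
  show "wf_circuit pipeline"
    by (rule wf_pipeline)
next
  assume flow: "ensures_flow_equivalence (desync_graph pipeline) pipeline (\<lambda>_. Num 0)"
  have "Even 1 \<in> latches pipeline" "transparency_of stale_trace (Even 1) = Opaque"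
    by (simp_all add: latches_pipeline stale_trace_def)
  then have "Num 0 = sync pipeline (\<lambda>_. Num 0) (count_list stale_trace (Fall (Even 1))) (Even 1)"
    using flow reaches_stale_trace async_stale_trace
    unfolding ensures_flow_equivalence_def by blast
  moreover have "count_list stale_trace (Fall (Even 1)) = 2"
    by (simp add: stale_trace_def)
  ultimately show False
    by (simp only: sync_pipeline) simp
qed

end
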